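(* Let $k$ be a positive integer and $n>1$ an odd integer. Then $$\prod_{d\mid n}\binom{kd-1}{(d-1)/2}^{\mu(n/d)}\equiv (-1)^{\phi(n)/2}\,4^{k\phi(n)} \begin{cases} \pmod{n^3} & \text{if }3\nmid n,\\ \pmod{n^3/3} & \text{if }3\mid n. \end{cases}$$
   Context: $\phi$ is Euler's totient function and $\mu$ the Möbius function; the product runs over all positive divisors $d$ of $n$ and is a rational number. Congruences between rational numbers modulo a positive integer $M$ mean that the difference equals $M$ times a rational number whose denominator is coprime to $M$. *)

theory Defs
  imports "HOL-Number_Theory.Totient" "HOL-Computational_Algebra.Squarefree"
begin

definition moebius_mu :: "nat \<Rightarrow> int" where
  "moebius_mu n = (if squarefree n then (- 1) ^ card (prime_factors n) else 0)"

(* quotient_of r is the pair (numerator, denominator) of r in lowest terms,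
   with positive denominator. *)
definition rat_cong :: "rat \<Rightarrow> rat \<Rightarrow> nat \<Rightarrow> bool" where
  "rat_cong x y M \<longleftrightarrow>
     (\<exists>r. x - y = of_nat M * r \<and> coprime (snd (quotient_of r)) (int M))"

end

theory Submission
  imports Defs
begin

text \<open>
  Let \<open>J\<close> be the set of \<open>0 < j < n/2\<close> coprime to \<open>n\<close>. Writing each binomial coefficient as
  a product of factors \<open>(kn - j)/j\<close> over the multiples \<open>j\<close> of \<open>n/d\<close> below \<open>n/2\<close>, Moebius inversion
  turns the left-hand side into \<open>\<Prod>j\<in>J. (kn - j)/j\<close>, that is, \<open>(-1)^(\<phi>(n)/2) Q(2k)\<close> with
  \<open>Q(m) = \<Prod>j\<in>J. 1 - m n/(2j)\<close>.

  From \<open>(1 - ma)(1 - a) = (1 - (m+1)a)(1 + m a\<^sup>2) + O(a\<^sup>3)\<close>, and since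
  \<open>n\<close> divides three times the sum of the \<open>j\<^sup>-\<^sup>2\<close> over \<open>J\<close>, one gets \<open>Q(m) \<equiv> Q(1)^m\<close>.
  Splitting the totatives of \<open>n\<close> both as \<open>J \<union> (n - J)\<close> and as \<open>2J \<union> (n - 2J)\<close> and comparing
  the two products gives \<open>Q(2) \<equiv> 2^\<phi>(n) Q(1)\<close>. Hence \<open>Q(1) \<equiv> 2^\<phi>(n)\<close>
  and \<open>Q(2k) \<equiv> 4^(k\<phi>(n))\<close>.
\<close>

section \<open>Moebius inversion in multiplicative form\<close>

lemma power_int_prod:
  fixes f :: "'a \<Rightarrow> 'b :: field"
  shows "prod f A powi m = (\<Prod>x\<in>A. f x powi m)"
  by (induction A rule: infinite_finite_induct) (auto simp: power_int_mult_distrib)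

lemma power_int_sum:
  fixes x :: "'a :: field"
  assumes "x \<noteq> 0"
  shows "x powi sum g A = (\<Prod>i\<in>A. x powi g i)"
  using assms by (induction A rule: infinite_finite_induct) (auto simp: power_int_add)

lemma moebius_mu_prime_mult:
  assumes "prime p" and "\<not> p dvd e"
  shows "moebius_mu (p * e) = - moebius_mu e"
proof -
  have cop: "coprime p e"
    using assms by (simp add: prime_imp_coprime)
  have "e \<noteq> 0" "p \<noteq> 0"
    using assms by (metis dvd_0_right, auto)
  then have "prime_factors (p * e) = insert p (prime_factors e)"
    using assms by (simp add: prime_factors_product prime_prime_factors)
  moreover have "p \<notin> prime_factors e"
    using assms by auto
  moreover have "squarefree (p * e) \<longleftrightarrow> squarefree e"
    using cop assms(1)
    by (metis squarefree_mult_coprime squarefree_multD(2) squarefree_prime)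
  ultimately show ?thesis
    by (simp add: moebius_mu_def)
qed

lemma sum_moebius_mu_divisors:
  assumes "m > 0"
  shows "(\<Sum>e | e dvd m. moebius_mu e) = (if m = 1 then 1 else 0)"
proof (cases "m = 1")
  case True
  then show ?thesis by (simp add: moebius_mu_def)
next
  case False
  then obtain p where p: "prime p" "p dvd m"
    using prime_factor_nat by blast
  \<comment> \<open>Squarefreeness in \<open>?B\<close> guarantees that \<open>e div p\<close> is no
    longer divisible by \<open>p\<close>, so that division by \<open>p\<close> lands in
    \<open>?A\<close>.\<close>
  let ?A = "{e. e dvd m \<and> \<not> p dvd e}" and ?B = "{e. e dvd m \<and> p dvd e \<and> squarefree e}"
  have fin: "finite {e. e dvd m}"
    using assms by simp
  have "(\<Sum>e | e dvd m. moebius_mu e) = (\<Sum>e\<in>?A \<union> ?B. moebius_mu e)"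
    using fin by (intro sum.mono_neutral_right) (auto simp: moebius_mu_def)
  also have "\<dots> = (\<Sum>e\<in>?A. moebius_mu e) + (\<Sum>e\<in>?B. moebius_mu e)"
    by (intro sum.union_disjoint finite_subset[OF _ fin]) auto
  \<comment> \<open>Multiplication by \<open>p\<close> pairs the two parts with opposite signs.\<close>
  also have "(\<Sum>e\<in>?B. moebius_mu e) = (\<Sum>e | e \<in> ?A \<and> squarefree e. moebius_mu (p * e))"
  proof (rule sum.reindex_bij_witness[where i = "\<lambda>e. p * e" and j = "\<lambda>e. e div p"])
    fix e assume e: "e \<in> ?B"
    then obtain q where q: "e = p * q" by auto
    have "\<not> p dvd q"
    proof
      assume "p dvd q"
      then have "p ^ 2 dvd e" by (simp add: q power2_eq_square)
      then show False
        using e p(1) squarefreeD[of e p] by auto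
    qed
    then show "e div p \<in> {e. e \<in> ?A \<and> squarefree e}"
      using e p(1) q squarefree_multD(2)[of p q] by (auto dest: dvd_mult_right simp: prime_gt_0_nat)
  next
    fix e assume e: "e \<in> {e. e \<in> ?A \<and> squarefree e}"
    then have "coprime p e" using p(1) by (simp add: prime_imp_coprime)
    then show "p * e \<in> ?B"
      using e p by (auto intro: divides_mult squarefree_mult_coprime squarefree_prime)
  qed (use p(1) in \<open>auto simp: prime_gt_0_nat\<close>)
  also have "\<dots> = (\<Sum>e | e \<in> ?A \<and> squarefree e. - moebius_mu e)"
    using p(1) by (intro sum.cong) (auto simp: moebius_mu_prime_mult)
  \<comment> \<open>The divisors in \<open>?A\<close> that are not squarefree contribute 0;
    restoring them makes this sum cancel the one over \<open>?A\<close>.\<close>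
  also have "\<dots> = (\<Sum>e\<in>?A. - moebius_mu e)"
    by (intro sum.mono_neutral_left finite_subset[OF _ fin]) (auto simp: moebius_mu_def)
  finally show ?thesis
    using False by (simp add: sum_negf)
qed

text \<open>After the two products are interchanged, \<open>f j\<close> carries the exponent \<Sum>
  \<open>moebius_mu e\<close> over \<open>e dvd gcd j n\<close>, which is 1 or 0 according to
  whether \<open>j\<close> is coprime to \<open>n\<close>. Exponents may be negative and are added,
  hence the nonvanishing of \<open>f\<close>.\<close>

lemma prod_moebius_mu_coprime:
  fixes f :: "nat \<Rightarrow> 'a :: field"
  assumes "finite H" and "n > 0" and "\<And>j. j \<in> H \<Longrightarrow> f j \<noteq> 0"
  shows "(\<Prod>d | d dvd n. (\<Prod>j | j \<in> H \<and> n div d dvd j. f j) powi moebius_mu (n div d))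
       = (\<Prod>j | j \<in> H \<and> coprime j n. f j)"
proof -
  have "(\<Prod>d | d dvd n. (\<Prod>j | j \<in> H \<and> n div d dvd j. f j) powi moebius_mu (n div d))
      = (\<Prod>e | e dvd n. (\<Prod>j | j \<in> H \<and> e dvd j. f j) powi moebius_mu e)"
    using assms(2)
    by (intro prod.reindex_bij_witness[where i = "\<lambda>e. n div e" and j = "\<lambda>d. n div d"])
       (auto simp: div_dvd_iff_mult elim!: dvdE)
  also have "\<dots> = (\<Prod>e | e dvd n. \<Prod>j | j \<in> H \<and> e dvd j. f j powi moebius_mu e)"
    by (simp add: power_int_prod)
  also have "\<dots> = (\<Prod>j\<in>H. \<Prod>e | e \<in> {e. e dvd n} \<and> e dvd j. f j powi moebius_mu e)"
    using assms by (intro prod.swap_restrict) auto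
  also have "\<dots> = (\<Prod>j\<in>H. if coprime j n then f j else 1)"
  proof (rule prod.cong[OF refl])
    fix j assume j: "j \<in> H"
    have "(\<Prod>e | e \<in> {e. e dvd n} \<and> e dvd j. f j powi moebius_mu e)
        = f j powi (\<Sum>e | e dvd gcd j n. moebius_mu e)"
      using assms(3)[OF j] by (subst power_int_sum) (auto intro!: prod.cong)
    also have "\<dots> = (if coprime j n then f j else 1)"
      using assms(2) by (subst sum_moebius_mu_divisors) (auto simp: coprime_iff_gcd_eq_1)
    finally show "(\<Prod>e | e \<in> {e. e dvd n} \<and> e dvd j. f j powi moebius_mu e)
        = (if coprime j n then f j else 1)" .
  qed
  also have "\<dots> = (\<Prod>j | j \<in> H \<and> coprime j n. f j)"
    using assms(1) by (simp add: prod.inter_filter)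
  finally show ?thesis .
qed

section \<open>Binomial coefficients as products over multiples\<close>

text \<open>Through \<open>gchoose\<close>, the recurrence in \<open>r\<close> holds without a bound
  on \<open>r\<close>; for \<open>r\<close> \<ge> \<open>a\<close> both sides are 0.\<close>

lemma binomial_eq_prod_div:
  assumes "a > 0"
  shows "(of_nat ((a - 1) choose r) :: 'a :: field_char_0)
       = (\<Prod>i\<in>{0<..r}. (of_nat a - of_nat i) / of_nat i)"
proof -
  have "(of_nat ((a - 1) choose r) :: 'a) = (of_nat a - 1) gchoose r"
    using assms by (simp add: binomial_gbinomial of_nat_diff)
  also have "\<dots> = (\<Prod>i\<in>{0<..r}. (of_nat a - of_nat i) / of_nat i)"
  proof (induction r)
    case (Suc r)
    have "of_nat (Suc r) * ((of_nat a - 1 :: 'a) gchoose Suc r)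
        = (of_nat a - of_nat (Suc r)) * ((of_nat a - 1) gchoose r)"
      using gbinomial_mult_1[of "of_nat a - 1 :: 'a" r] by (simp add: algebra_simps)
    then have "((of_nat a - 1 :: 'a) gchoose Suc r)
        = (of_nat a - of_nat (Suc r)) / of_nat (Suc r) * ((of_nat a - 1) gchoose r)"
      by (simp add: field_simps del: of_nat_Suc)
    moreover have "{0<..Suc r} = insert (Suc r) {0<..r}" by auto
    ultimately show ?case
      using Suc.IH by simp
  qed simp
  finally show ?thesis .
qed

text \<open>Scaling \<open>i\<close> to \<open>j = i * e\<close> with \<open>e = n div d\<close>
  turns \<open>(kd - i)/i\<close> into \<open>(kn - j)/j\<close>. The factor no longer depends on
  \<open>d\<close>, which is the shape that \<open>prod_moebius_mu_coprime\<close> handles.\<close>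

lemma binomial_eq_prod_multiples:
  assumes "odd n" and "d dvd n" and "k > 0"
  shows "(of_nat ((k * d - 1) choose ((d - 1) div 2)) :: 'a :: field_char_0)
       = (\<Prod>j | j \<in> {j. 0 < j \<and> 2 * j < n} \<and> n div d dvd j. (of_nat (k * n) - of_nat j) / of_nat j)"
proof -
  obtain e where n: "n = d * e" using assms(2) by auto
  have pos: "d > 0" "e > 0" "odd d" "odd e" using assms(1) n by (auto simp: odd_pos)
  \<comment> \<open>Since \<open>d\<close> is odd, the upper limit is a strict inequality that
    scales by \<open>e\<close> to \<open>2 * j < n\<close>.\<close>
  have half: "i \<le> (d - 1) div 2 \<longleftrightarrow> 2 * i < d" for i
    using pos by (auto elim!: oddE)
  have "(of_nat ((k * d - 1) choose ((d - 1) div 2)) :: 'a)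
      = (\<Prod>i\<in>{0<..(d - 1) div 2}. (of_nat (k * d) - of_nat i) / of_nat i)"
    using assms pos by (intro binomial_eq_prod_div) auto
  also have "\<dots> = (\<Prod>j | j \<in> {j. 0 < j \<and> 2 * j < n} \<and> e dvd j. (of_nat (k * n) - of_nat j) / of_nat j)"
  proof (rule prod.reindex_bij_witness[where i = "\<lambda>j. j div e" and j = "\<lambda>i. i * e"])
    fix i assume "i \<in> {0<..(d - 1) div 2}"
    then show "(of_nat (k * n) - of_nat (i * e)) / of_nat (i * e) = (of_nat (k * d) - of_nat i) / (of_nat i :: 'a)"
      using pos by (simp add: n field_simps)
  qed (use pos in \<open>auto simp: n half elim!: dvdE\<close>)
  finally show ?thesis
    using pos n by simp
qed

section \<open>Two splittings of the totatives\<close>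

lemma (in comm_monoid_set) union_images:
  assumes "finite J" and "inj_on a J" and "inj_on b J" and "a ` J \<inter> b ` J = {}"
  shows "F g (a ` J \<union> b ` J) = F (\<lambda>j. g (a j) \<^bold>* g (b j)) J"
  using assms by (simp add: union_disjoint reindex distrib)

definition half_totatives :: "nat \<Rightarrow> nat set" where
  "half_totatives n = {j. 0 < j \<and> 2 * j < n \<and> coprime j n}"

lemma finite_half_totatives [simp]: "finite (half_totatives n)"
  by (rule finite_subset[of _ "{..n}"]) (auto simp: half_totatives_def)

context
  fixes n :: nat
  assumes n: "n > 1" "odd n"
begin

lemma coprime_diff_iff: "j \<le> n \<Longrightarrow> coprime (n - j) n \<longleftrightarrow> coprime j n"
  by (simp add: coprime_iff_gcd_eq_1 gcd_diff2_nat)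

lemma coprime_double_iff: "coprime (2 * j) n \<longleftrightarrow> coprime j n"
  using n by auto

text \<open>Exactly one of \<open>x\<close> and \<open>n - x\<close> lies below n/2, because
  \<open>n\<close> is odd.\<close>

lemma totatives_eq_reflect:
  "totatives n = (\<lambda>j. j) ` half_totatives n \<union> (\<lambda>j. n - j) ` half_totatives n" (is "_ = ?R")
proof
  show "?R \<subseteq> totatives n"
    by (auto simp: totatives_def half_totatives_def coprime_diff_iff)
  show "totatives n \<subseteq> ?R"
  proof
    fix x assume x: "x \<in> totatives n"
    then have lt: "0 < x" "x < n" "coprime x n"
      using n totatives_less[of x n] by (auto simp: totatives_def)
    have "2 * x \<noteq> n" using n by auto
    then consider "2 * x < n" | "2 * (n - x) < n" using lt by linarith
    then show "x \<in> ?R"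
    proof cases
      case 2
      then have "n - x \<in> half_totatives n" "x = n - (n - x)"
        using lt by (auto simp: half_totatives_def coprime_diff_iff)
      then show ?thesis by blast
    qed (use lt in \<open>auto simp: half_totatives_def\<close>)
  qed
qed

text \<open>Here the split is by parity: for odd \<open>x\<close> the difference
  \<open>n - x\<close> is even, and 2 is a unit modulo \<open>n\<close>.\<close>

lemma totatives_eq_double:
  "totatives n = (\<lambda>j. 2 * j) ` half_totatives n \<union> (\<lambda>j. n - 2 * j) ` half_totatives n" (is "_ = ?R")
proof
  show "?R \<subseteq> totatives n"
    using n by (auto simp: totatives_def half_totatives_def coprime_diff_iff)
  show "totatives n \<subseteq> ?R"
  proof
    fix x assume x: "x \<in> totatives n"
    then have lt: "0 < x" "x < n" "coprime x n"
      using n totatives_less[of x n] by (auto simp: totatives_def)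
    show "x \<in> ?R"
    proof (cases "even x")
      case True
      then obtain y where "x = 2 * y" by auto
      then show ?thesis using lt by (auto simp: half_totatives_def)
    next
      case False
      then have "even (n - x)" using n lt by simp
      then obtain y where y: "n - x = 2 * y" by (rule evenE)
      then have "x = n - 2 * y" using lt by simp
      moreover have "y \<in> half_totatives n"
        using lt y coprime_diff_iff[of x] coprime_double_iff[of y] by (auto simp: half_totatives_def)
      ultimately show ?thesis by blast
    qed
  qed
qed

lemma reflect_double_inj:
  "inj_on (\<lambda>j. n - j) (half_totatives n)" "inj_on (\<lambda>j. n - 2 * j) (half_totatives n)"
  "(\<lambda>j. j) ` half_totatives n \<inter> (\<lambda>j. n - j) ` half_totatives n = {}"
  "(\<lambda>j. 2 * j) ` half_totatives n \<inter> (\<lambda>j. n - 2 * j) ` half_totatives n = {}"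
proof -
  show "(\<lambda>j. 2 * j) ` half_totatives n \<inter> (\<lambda>j. n - 2 * j) ` half_totatives n = {}"
  proof -
    have "2 * i \<noteq> n - 2 * j" if "j \<in> half_totatives n" for i j
    proof
      assume "2 * i = n - 2 * j"
      then have "n = 2 * (i + j)" using that by (simp add: half_totatives_def)
      then show False using n by simp
    qed
    then show ?thesis by blast
  qed
qed (auto simp: half_totatives_def inj_on_def)

text \<open>Both sides are the product of \<open>g\<close> over all totatives of
  \<open>n\<close>.\<close>

lemma prod_half_totatives:
  "(\<Prod>j\<in>half_totatives n. g j * g (n - j)) = (\<Prod>j\<in>half_totatives n. g (2 * j) * g (n - 2 * j))"
proof -
  have "prod g (totatives n) = (\<Prod>j\<in>half_totatives n. g j * g (n - j))"
    by (subst totatives_eq_reflect, subst prod.union_images) (auto simp: reflect_double_inj[simplified])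
  moreover have "prod g (totatives n) = (\<Prod>j\<in>half_totatives n. g (2 * j) * g (n - 2 * j))"
    by (subst totatives_eq_double, subst prod.union_images) (use reflect_double_inj in \<open>auto simp: inj_on_def\<close>)
  ultimately show ?thesis by simp
qed

lemma sum_half_totatives:
  "(\<Sum>j\<in>half_totatives n. g j + g (n - j)) = (\<Sum>j\<in>half_totatives n. g (2 * j) + g (n - 2 * j))"
proof -
  have "sum g (totatives n) = (\<Sum>j\<in>half_totatives n. g j + g (n - j))"
    by (subst totatives_eq_reflect, subst sum.union_images) (auto simp: reflect_double_inj[simplified])
  moreover have "sum g (totatives n) = (\<Sum>j\<in>half_totatives n. g (2 * j) + g (n - 2 * j))"
    by (subst totatives_eq_double, subst sum.union_images) (use reflect_double_inj in \<open>auto simp: inj_on_def\<close>)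
  ultimately show ?thesis by simp
qed

lemma card_half_totatives: "2 * card (half_totatives n) = totient n"
  using sum.union_images[of "half_totatives n" "\<lambda>j. j" "\<lambda>j. n - j" "\<lambda>_. 1 :: nat"]
  by (simp add: totient_def totatives_eq_reflect reflect_double_inj[simplified])

end

section \<open>Congruences for products of factors close to 1\<close>

text \<open>In the expanded product every term of degree at least 2 vanishes modulo
  \<open>M\<close>.\<close>

lemma prod_one_plus_cong:
  fixes b :: "'a \<Rightarrow> int"
  assumes "finite J" and "\<And>i j. i \<in> J \<Longrightarrow> j \<in> J \<Longrightarrow> M dvd b i * b j"
  shows "[(\<Prod>j\<in>J. 1 + b j) = 1 + (\<Sum>j\<in>J. b j)] (mod M)"
  using assms
proof (induction J rule: finite_induct)
  case (insert x J)
  have "M dvd (\<Sum>j\<in>J. b x * b j)"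
    using insert.prems by (intro dvd_sum) auto
  then have "[b x * (\<Sum>j\<in>J. b j) = 0] (mod M)"
    by (simp add: cong_0_iff sum_distrib_left)
  moreover have "[(1 + b x) * (\<Prod>j\<in>J. 1 + b j) = (1 + b x) * (1 + (\<Sum>j\<in>J. b j))] (mod M)"
    using insert by (intro cong_scalar_left) auto
  then have "[(1 + b x) * (\<Prod>j\<in>J. 1 + b j) = 1 + b x + (\<Sum>j\<in>J. b j) + b x * (\<Sum>j\<in>J. b j)] (mod M)"
    by (simp add: algebra_simps)
  ultimately have "[(1 + b x) * (\<Prod>j\<in>J. 1 + b j) = 1 + b x + (\<Sum>j\<in>J. b j) + 0] (mod M)"
    by (meson cong_add_lcancel cong_trans)
  then show ?case
    using insert.hyps by (simp add: add.assoc)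
qed simp

text \<open>Induction on \<open>m\<close>. Passing from \<open>m\<close> to \<open>Suc m\<close>
  costs the factors \<open>1 + m * (a j)\<^sup>2\<close>; products of two of the squares vanish
  modulo \<open>M\<close>, so these factors multiply to 1 plus \<open>m\<close> times the sum of
  squares, which is 1 modulo \<open>M\<close>.\<close>

lemma prod_one_minus_mult_cong:
  fixes a :: "'a \<Rightarrow> int"
  assumes "finite J" and triple: "\<And>i j l. i \<in> J \<Longrightarrow> j \<in> J \<Longrightarrow> l \<in> J \<Longrightarrow> M dvd a i * a j * a l"
    and squares: "M dvd (\<Sum>j\<in>J. (a j)\<^sup>2)"
  shows "[(\<Prod>j\<in>J. 1 - int m * a j) = (\<Prod>j\<in>J. 1 - a j) ^ m] (mod M)"
proof (induction m)
  case (Suc m)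
  let ?Q = "\<lambda>m. \<Prod>j\<in>J. 1 - int m * a j"
  have "[?Q m * (\<Prod>j\<in>J. 1 - a j) = ?Q (Suc m) * (\<Prod>j\<in>J. 1 + int m * (a j)\<^sup>2)] (mod M)"
    unfolding prod.distrib[symmetric]
  proof (rule cong_prod)
    fix j assume j: "j \<in> J"
    have "M dvd (int m * int (Suc m)) * (a j * a j * a j)"
      using triple[OF j j j] by (rule dvd_mult)
    moreover have "(1 - int m * a j) * (1 - a j) - (1 - int (Suc m) * a j) * (1 + int m * (a j)\<^sup>2)
        = (int m * int (Suc m)) * (a j * a j * a j)"
      by (simp add: algebra_simps power2_eq_square)
    ultimately show "[(1 - int m * a j) * (1 - a j)
        = (1 - int (Suc m) * a j) * (1 + int m * (a j)\<^sup>2)] (mod M)"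
      by (simp only: cong_iff_dvd_diff)
  qed
  moreover have "[(\<Prod>j\<in>J. 1 + int m * (a j)\<^sup>2) = 1] (mod M)"
  proof -
    have "M dvd (int m * (a i)\<^sup>2) * (int m * (a j)\<^sup>2)" if "i \<in> J" "j \<in> J" for i j
    proof -
      have "M dvd (a i * a i * a j) * (int m * int m * a j)"
        using triple[OF that(1) that(1) that(2)] by (rule dvd_mult2)
      then show ?thesis by (simp add: power2_eq_square mult_ac)
    qed
    then have "[(\<Prod>j\<in>J. 1 + int m * (a j)\<^sup>2) = 1 + (\<Sum>j\<in>J. int m * (a j)\<^sup>2)] (mod M)"
      using assms(1) by (intro prod_one_plus_cong)
    moreover have "[(\<Sum>j\<in>J. int m * (a j)\<^sup>2) = 0] (mod M)"
      using squares by (simp add: cong_0_iff sum_distrib_left[symmetric])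
    then have "[1 + (\<Sum>j\<in>J. int m * (a j)\<^sup>2) = 1 + 0] (mod M)"
      by (intro cong_add cong_refl)
    ultimately show ?thesis
      using cong_trans by fastforce
  qed
  then have "[?Q (Suc m) * (\<Prod>j\<in>J. 1 + int m * (a j)\<^sup>2) = ?Q (Suc m) * 1] (mod M)"
    by (rule cong_scalar_left)
  ultimately have "[?Q m * (\<Prod>j\<in>J. 1 - a j) = ?Q (Suc m)] (mod M)"
    using cong_trans by fastforce
  then have "[?Q (Suc m) = ?Q m * (\<Prod>j\<in>J. 1 - a j)] (mod M)"
    by (rule cong_sym)
  also have "[?Q m * (\<Prod>j\<in>J. 1 - a j) = (\<Prod>j\<in>J. 1 - a j) ^ m * (\<Prod>j\<in>J. 1 - a j)] (mod M)"
    using Suc.IH by (rule cong_scalar_right)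
  finally show ?case
    by (simp add: mult.commute)
qed simp

section \<open>Inverse squares and the origin of the modulus\<close>

lemma cong_inverse_unique:
  fixes z :: int
  assumes "[z * x = 1] (mod N)" and "[z * y = 1] (mod N)"
  shows "[x = y] (mod N)"
proof -
  have "[x * (z * y) = x * 1] (mod N)"
    using assms(2) by (rule cong_scalar_left)
  moreover have "[(z * x) * y = 1 * y] (mod N)"
    using assms(1) by (rule cong_scalar_right)
  ultimately show ?thesis
    by (simp add: mult_ac cong_def)
qed

text \<open>Let \<open>T\<close> be the sum of the inverse squares over all totatives and
  \<open>S\<close> the sum over the half set. Reflection gives \<open>T\<close> \<equiv>
  \<open>2 * S\<close> and doubling gives \<open>4 * T\<close> \<equiv> \<open>2 * S\<close>, so
  \<open>n\<close> divides \<open>6 * S\<close>, and 2 can be cancelled because \<open>n\<close> is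
  odd.\<close>

lemma inverse_squares_half_sum:
  fixes \<iota> :: "nat \<Rightarrow> int"
  assumes n: "n > 1" "odd n"
    and inv: "\<And>j. coprime j n \<Longrightarrow> [int j * \<iota> j = 1] (mod int n)"
  shows "int n dvd 3 * (\<Sum>j\<in>half_totatives n. (\<iota> j)\<^sup>2)"
proof -
  let ?J = "half_totatives n"
  define S where "S = (\<Sum>j\<in>?J. (\<iota> j)\<^sup>2)"
  have refl: "[(\<iota> (n - j))\<^sup>2 = (\<iota> j)\<^sup>2] (mod int n)" if j: "coprime j n" "j < n" for j
  proof -
    have "[int (n - j) * - \<iota> j = int j * \<iota> j] (mod int n)"
      using j by (simp add: cong_iff_dvd_diff of_nat_diff algebra_simps)
    then have "[int (n - j) * - \<iota> j = 1] (mod int n)"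
      using inv[OF j(1)] by (rule cong_trans)
    moreover have "[int (n - j) * \<iota> (n - j) = 1] (mod int n)"
      using n j by (intro inv) (simp add: coprime_diff_iff)
    ultimately have "[\<iota> (n - j) = - \<iota> j] (mod int n)"
      using cong_inverse_unique by blast
    then show ?thesis
      using cong_pow[of "\<iota> (n - j)" "- \<iota> j" "int n" 2] by simp
  qed
  have double: "[4 * (\<iota> (2 * j))\<^sup>2 = (\<iota> j)\<^sup>2] (mod int n)" if j: "coprime j n" for j
  proof -
    have "[int (2 * j) * \<iota> (2 * j) = 1] (mod int n)"
      using j n by (intro inv) simp
    then have "[int j * (2 * \<iota> (2 * j)) = 1] (mod int n)"
      by (simp add: mult_ac)
    then have "[2 * \<iota> (2 * j) = \<iota> j] (mod int n)"
      using inv[OF j] by (rule cong_inverse_unique)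
    then show ?thesis
      using cong_pow[of "2 * \<iota> (2 * j)" "\<iota> j" "int n" 2] by (simp add: power_mult_distrib)
  qed
  have "[(\<Sum>j\<in>?J. (\<iota> j)\<^sup>2 + (\<iota> (n - j))\<^sup>2) = (\<Sum>j\<in>?J. (\<iota> j)\<^sup>2 + (\<iota> j)\<^sup>2)] (mod int n)"
    by (intro cong_sum cong_add cong_refl refl) (auto simp: half_totatives_def)
  then have one: "[(\<Sum>j\<in>?J. (\<iota> j)\<^sup>2 + (\<iota> (n - j))\<^sup>2) = 2 * S] (mod int n)"
    by (simp add: S_def sum.distrib sum_distrib_left)
  have "[4 * ((\<iota> (2 * j))\<^sup>2 + (\<iota> (n - 2 * j))\<^sup>2) = 2 * (\<iota> j)\<^sup>2] (mod int n)" if "j \<in> ?J" for j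
  proof -
    have j: "coprime j n" "2 * j < n" "coprime (2 * j) n"
      using that n by (auto simp: half_totatives_def)
    have "[4 * (\<iota> (2 * j))\<^sup>2 + 4 * (\<iota> (n - 2 * j))\<^sup>2 = 4 * (\<iota> (2 * j))\<^sup>2 + 4 * (\<iota> (2 * j))\<^sup>2] (mod int n)"
      using j by (intro cong_add cong_refl cong_scalar_left refl)
    also have "[4 * (\<iota> (2 * j))\<^sup>2 + 4 * (\<iota> (2 * j))\<^sup>2 = (\<iota> j)\<^sup>2 + (\<iota> j)\<^sup>2] (mod int n)"
      using j by (intro cong_add double)
    finally show ?thesis by simp
  qed
  then have "[(\<Sum>j\<in>?J. 4 * ((\<iota> (2 * j))\<^sup>2 + (\<iota> (n - 2 * j))\<^sup>2)) = (\<Sum>j\<in>?J. 2 * (\<iota> j)\<^sup>2)] (mod int n)"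
    by (rule cong_sum)
  then have "[4 * (\<Sum>j\<in>?J. (\<iota> j)\<^sup>2 + (\<iota> (n - j))\<^sup>2) = 2 * S] (mod int n)"
    using sum_half_totatives[OF n, of "\<lambda>j. (\<iota> j)\<^sup>2"] by (simp add: S_def sum_distrib_left)
  moreover have "[4 * (\<Sum>j\<in>?J. (\<iota> j)\<^sup>2 + (\<iota> (n - j))\<^sup>2) = 4 * (2 * S)] (mod int n)"
    using one by (rule cong_scalar_left)
  ultimately have "[4 * (2 * S) = 2 * S] (mod int n)"
    using cong_sym cong_trans by blast
  then have "int n dvd 2 * (3 * S)"
    by (simp add: cong_iff_dvd_diff)
  moreover have "coprime (int n) 2"
    using n by simp
  ultimately show ?thesis
    unfolding S_def using coprime_dvd_mult_right_iff by blast
qed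

text \<open>This is where the case distinction in the modulus comes from: if 3 divides
  \<open>n\<close>, only \<open>n div 3\<close> is known to divide \<open>S\<close>, and one factor
  3 is lost.\<close>

lemma cube_modulus_dvd:
  fixes n :: nat and S :: int
  assumes "int n dvd 3 * S"
  shows "int (if 3 dvd n then n ^ 3 div 3 else n ^ 3) dvd (int n)\<^sup>2 * S"
proof (cases "3 dvd n")
  case True
  then obtain m where m: "n = 3 * m" by auto
  then have "int m dvd S" using assms by auto
  then have "(int n)\<^sup>2 * int m dvd (int n)\<^sup>2 * S" by (rule mult_dvd_mono[OF dvd_refl])
  moreover have "n ^ 3 div 3 = n\<^sup>2 * m"
    by (simp add: m power2_eq_square power3_eq_cube)
  ultimately show ?thesis using True by simp
next
  case False
  then have "coprime (int n) 3"
    using prime_imp_coprime[of 3 n] by (simp add: coprime_commute flip: coprime_int_iff)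
  then have "int n dvd S"
    using assms by (simp add: coprime_dvd_mult_right_iff)
  then have "(int n)\<^sup>2 * int n dvd (int n)\<^sup>2 * S" by (rule mult_dvd_mono[OF dvd_refl])
  then show ?thesis
    using False by (simp add: power2_eq_square power3_eq_cube)
qed

lemma cube_modulus_dvd_cube:
  fixes n :: nat
  shows "(if 3 dvd n then n ^ 3 div 3 else n ^ 3) dvd n ^ 3"
  by (auto simp: power3_eq_cube elim!: dvdE)

section \<open>The main congruence over the integers\<close>

text \<open>The target congruence with denominators cleared, so that the argument can run in the
  integers.\<close>

lemma prod_half_totatives_cong:
  fixes k n :: nat
  assumes n: "n > 1" "odd n"
  defines "M \<equiv> int (if 3 dvd n then n ^ 3 div 3 else n ^ 3)"
  shows "[(\<Prod>j\<in>half_totatives n. int (k * n) - int j)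
        = (\<Prod>j\<in>half_totatives n. int j) * ((- 1) ^ (totient n div 2) * 4 ^ (k * totient n))] (mod M)"
proof -
  let ?J = "half_totatives n"
  define N where "N = int n ^ 3"
  have MN: "M dvd N"
    unfolding M_def N_def using cube_modulus_dvd_cube[of n] by (metis of_nat_dvd_iff of_nat_power)
  have coprime_M: "coprime x M" if "coprime x (int n)" for x
    using that MN coprime_power_right_iff[of x "int n" 3] coprime_divisors[OF dvd_refl MN]
    by (auto simp: N_def)
  \<comment> \<open>\<open>N\<close> is a multiple of both \<open>M\<close> and \<open>n\<close>, so
    inverses modulo \<open>N\<close> serve for either modulus.\<close>
  have "\<exists>x. coprime j n \<longrightarrow> [int j * x = 1] (mod N)" for j
    using cong_solve_coprime_int[of "int j" N] by (auto simp: N_def)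
  then obtain \<iota> where \<iota>: "\<And>j. coprime j n \<Longrightarrow> [int j * \<iota> j = 1] (mod N)"
    by metis
  \<comment> \<open>Working in the integers modulo \<open>N\<close>, the quotient \<open>n/(2j)\<close> becomes \<open>a j\<close>.\<close>
  define h where "h = \<iota> 2"
  define a where "a j = int n * h * \<iota> j" for j
  define A where "A = (\<Prod>j\<in>?J. int j)"
  define Q where "Q m = (\<Prod>j\<in>?J. 1 - int m * a j)" for m
  have card: "totient n = 2 * card ?J"
    using card_half_totatives[OF n] by simp

  have h_inv: "[2 * h * (int j * \<iota> j) = 1] (mod N)" if "j \<in> ?J" for j
  proof -
    have "[(2 * h) * (int j * \<iota> j) = 1 * 1] (mod N)"
      using \<iota>[of 2] \<iota>[of j] that n unfolding h_def by (intro cong_mult) (auto simp: half_totatives_def)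
    then show ?thesis by simp
  qed
  \<comment> \<open>The coefficient is \<open>2 * k\<close> because \<open>a j\<close> stands for
    \<open>n/(2j)\<close>, whence \<open>kn/j\<close> becomes \<open>2 * k * a j\<close>.\<close>
  have factor_k: "[int (k * n) - int j = - int j * (1 - int (2 * k) * a j)] (mod M)" if "j \<in> ?J" for j k
  proof -
    have "N dvd 1 - 2 * h * (int j * \<iota> j)"
      using h_inv[OF that] by (metis cong_iff_dvd_diff cong_sym)
    then have "M dvd int (k * n) * (1 - 2 * h * (int j * \<iota> j))"
      using MN dvd_trans dvd_mult by blast
    then show ?thesis
      by (simp add: cong_iff_dvd_diff a_def algebra_simps)
  qed
  have factor_double: "[int n - 2 * int j = - (2 * int j) * (1 - a j)] (mod M)" if "j \<in> ?J" for j
  proof -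
    have "N dvd 1 - 2 * h * (int j * \<iota> j)"
      using h_inv[OF that] by (metis cong_iff_dvd_diff cong_sym)
    then have "M dvd int n * (1 - 2 * h * (int j * \<iota> j))"
      using MN dvd_trans dvd_mult by blast
    then show ?thesis
      by (simp add: cong_iff_dvd_diff a_def algebra_simps)
  qed

  have prod_k: "[(\<Prod>j\<in>?J. int (k * n) - int j) = (- 1) ^ card ?J * A * Q (2 * k)] (mod M)" for k
  proof -
    have "[(\<Prod>j\<in>?J. int (k * n) - int j) = (\<Prod>j\<in>?J. - int j * (1 - int (2 * k) * a j))] (mod M)"
      by (intro cong_prod factor_k)
    also have "(\<Prod>j\<in>?J. - int j * (1 - int (2 * k) * a j)) = (- 1) ^ card ?J * A * Q (2 * k)"
      by (simp add: prod.distrib prod_uminus A_def Q_def)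
    finally show ?thesis .
  qed
  have prod_double: "[(\<Prod>j\<in>?J. int n - 2 * int j) = (- 1) ^ card ?J * (2 ^ card ?J * A) * Q 1] (mod M)"
  proof -
    have "[(\<Prod>j\<in>?J. int n - 2 * int j) = (\<Prod>j\<in>?J. - (2 * int j) * (1 - a j))] (mod M)"
      by (intro cong_prod factor_double)
    also have "(\<Prod>j\<in>?J. - (2 * int j) * (1 - a j)) = (- 1) ^ card ?J * (2 ^ card ?J * A) * Q 1"
      by (simp add: prod.distrib prod_uminus A_def Q_def)
    finally show ?thesis .
  qed

  have coprime_A: "coprime A (int n)"
    unfolding A_def by (intro prod_coprime_left) (auto simp: half_totatives_def)
  \<comment> \<open>Each \<open>a j\<close> is a multiple of \<open>n\<close>, so all factors are 1
    modulo \<open>n\<close>. This later allows cancelling \<open>Q 1\<close>.\<close>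
  have coprime_Q: "coprime (Q m) (int n)" for m
  proof -
    have "[1 - int m * a j = 1] (mod int n)" for j
      by (simp add: cong_iff_dvd_diff a_def)
    then have "coprime (1 - int m * a j) (int n)" for j
      by (metis cong_imp_coprime cong_sym coprime_1_left)
    then show ?thesis
      unfolding Q_def by (intro prod_coprime_left)
  qed

  have Q_power: "[Q m = Q 1 ^ m] (mod M)" for m
  proof -
    have "M dvd a i * a j * a l" for i j l
    proof -
      have "N dvd N * (h ^ 3 * (\<iota> i * \<iota> j * \<iota> l))" by simp
      also have "N * (h ^ 3 * (\<iota> i * \<iota> j * \<iota> l)) = a i * a j * a l"
        by (simp add: N_def a_def power3_eq_cube mult_ac)
      finally show ?thesis using MN dvd_trans by blast
    qed
    moreover have "M dvd (\<Sum>j\<in>?J. (a j)\<^sup>2)"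
    proof -
      have "[int j * \<iota> j = 1] (mod int n)" if "coprime j n" for j
        using \<iota>[OF that] by (rule cong_dvd_modulus) (simp add: N_def)
      then have "M dvd (int n)\<^sup>2 * (\<Sum>j\<in>?J. (\<iota> j)\<^sup>2)"
        unfolding M_def using n by (intro cube_modulus_dvd inverse_squares_half_sum)
      then have "M dvd h\<^sup>2 * ((int n)\<^sup>2 * (\<Sum>j\<in>?J. (\<iota> j)\<^sup>2))"
        by (rule dvd_mult)
      then show ?thesis
        by (simp add: a_def power_mult_distrib sum_distrib_left mult_ac)
    qed
    ultimately show ?thesis
      using prod_one_minus_mult_cong[of ?J M a m] by (simp add: Q_def)
  qed

  \<comment> \<open>The product of all totatives, computed by reflection and by doubling. The form
    \<open>1 * n\<close> below prepares for \<open>prod_k\<close> with \<open>k\<close> = 1, which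
    brings in \<open>Q 2\<close>, while \<open>prod_double\<close> brings in
    \<open>Q 1\<close>.\<close>
  have "(\<Prod>j\<in>?J. int j * int (n - j)) = (\<Prod>j\<in>?J. int (2 * j) * int (n - 2 * j))"
    using prod_half_totatives[OF n, of int] .
  moreover have "(\<Prod>j\<in>?J. int j * int (n - j)) = A * (\<Prod>j\<in>?J. int (1 * n) - int j)"
    unfolding A_def prod.distrib by (auto simp: half_totatives_def intro!: arg_cong2[where f = "(*)"] prod.cong)
  moreover have "(\<Prod>j\<in>?J. int (2 * j) * int (n - 2 * j)) = 2 ^ card ?J * A * (\<Prod>j\<in>?J. int n - 2 * int j)"
    unfolding A_def prod.distrib by (auto simp: prod.distrib half_totatives_def intro!: arg_cong2[where f = "(*)"] prod.cong)
  ultimately have eq: "A * (\<Prod>j\<in>?J. int (1 * n) - int j) = 2 ^ card ?J * A * (\<Prod>j\<in>?J. int n - 2 * int j)"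
    by simp
  have "[A * ((- 1) ^ card ?J * A * Q (2 * 1)) = A * (\<Prod>j\<in>?J. int (1 * n) - int j)] (mod M)"
    by (intro cong_scalar_left cong_sym[OF prod_k])
  also note eq
  also have "[2 ^ card ?J * A * (\<Prod>j\<in>?J. int n - 2 * int j)
      = 2 ^ card ?J * A * ((- 1) ^ card ?J * (2 ^ card ?J * A) * Q 1)] (mod M)"
    by (intro cong_scalar_left prod_double)
  finally have "[A * ((- 1) ^ card ?J * A * Q (2 * 1))
      = 2 ^ card ?J * A * ((- 1) ^ card ?J * (2 ^ card ?J * A) * Q 1)] (mod M)" .
  moreover have pow_two: "2 ^ totient n = (2 ^ card ?J * 2 ^ card ?J :: int)"
    by (simp add: card mult_2 power_add)
  ultimately have "[((- 1) ^ card ?J * A * A) * Q 2 = ((- 1) ^ card ?J * A * A) * (2 ^ totient n * Q 1)] (mod M)"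
    unfolding pow_two by (simp add: mult_ac)
  moreover have "coprime ((- 1) ^ card ?J * A * A) M"
    using coprime_M[OF coprime_A] by (simp add: minus_one_power_iff)
  ultimately have "[Q 2 = 2 ^ totient n * Q 1] (mod M)"
    by (simp only: cong_mult_lcancel)
  \<comment> \<open>Replacing \<open>Q 2\<close> by the square of \<open>Q 1\<close> leaves a common
    unit factor \<open>Q 1\<close> to cancel.\<close>
  with Q_power[of 2] have "[Q 1 * Q 1 = 2 ^ totient n * Q 1] (mod M)"
    by (metis cong_sym cong_trans power2_eq_square)
  then have Q1: "[Q 1 = 2 ^ totient n] (mod M)"
    using coprime_M[OF coprime_Q] by (simp only: cong_mult_rcancel)

  have "[Q (2 * k) = (2 ^ totient n) ^ (2 * k)] (mod M)"
    using Q_power[of "2 * k"] cong_pow[OF Q1, of "2 * k"] by (rule cong_trans)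
  moreover have "(2 ^ totient n) ^ (2 * k) = (4 ^ (k * totient n) :: int)"
  proof -
    have "(2 ^ totient n) ^ (2 * k) = ((2 ^ 2) ^ (k * totient n) :: int)"
      by (simp only: power_mult[symmetric] mult_ac)
    then show ?thesis by simp
  qed
  ultimately have "[(- 1) ^ card ?J * A * Q (2 * k) = (- 1) ^ card ?J * A * 4 ^ (k * totient n)] (mod M)"
    by (simp add: cong_scalar_left)
  with prod_k[of k] have "[(\<Prod>j\<in>?J. int (k * n) - int j) = (- 1) ^ card ?J * A * 4 ^ (k * totient n)] (mod M)"
    by (rule cong_trans)
  then show ?thesis
    by (simp add: card A_def mult_ac)
qed

section \<open>Passage to rational congruences\<close>

lemma snd_quotient_of_divide_dvd:
  assumes "b \<noteq> 0"
  shows "snd (quotient_of (of_int a / of_int b)) dvd b"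
proof -
  obtain p q where pq: "quotient_of (of_int a / of_int b) = (p, q)" by fastforce
  then have q: "q > 0" "coprime p q"
    by (auto intro: quotient_of_denom_pos quotient_of_coprime)
  have "(of_int a / of_int b :: rat) = of_int p / of_int q"
    using pq by (rule quotient_of_div)
  then have "(of_int (a * q) :: rat) = of_int (p * b)"
    using assms q by (simp add: field_simps)
  then have "a * q = p * b"
    by (simp only: of_int_eq_iff)
  then have "q dvd p * b"
    by (metis dvd_triv_right)
  then show ?thesis
    using q pq by (simp add: coprime_commute coprime_dvd_mult_right_iff)
qed

text \<open>If \<open>a - b * c = M * z\<close>, the witness for \<open>rat_cong\<close> is
  \<open>z / b\<close>; its reduced denominator divides \<open>b\<close> and is therefore coprime to
  \<open>M\<close>.\<close>

lemma rat_cong_divideI: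
  assumes "[a = b * c] (mod int M)" and "coprime b (int M)" and "b \<noteq> 0"
  shows "rat_cong (of_int a / of_int b) (of_int c) M"
proof -
  obtain z where "a - b * c = int M * z"
    using assms(1) by (auto simp: cong_iff_dvd_diff)
  then have "(of_int (a - b * c) :: rat) = of_int (int M * z)"
    by simp
  then have "(of_int a / of_int b :: rat) - of_int c = of_nat M * (of_int z / of_int b)"
    using assms(3) by (simp add: field_simps)
  moreover have "coprime (snd (quotient_of (of_int z / of_int b))) (int M)"
    using snd_quotient_of_divide_dvd[OF assms(3)] assms(2) coprime_divisors dvd_refl by blast
  ultimately show ?thesis
    unfolding rat_cong_def by blast
qed

theorem theorem2:
  fixes k n :: nat
  assumes "k > 0" and "n > 1" and "odd n"
  shows "rat_cong
           (\<Prod>d\<in>{d. d dvd n}.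
              (of_nat ((k * d - 1) choose ((d - 1) div 2)) :: rat) powi moebius_mu (n div d))
           ((- 1) ^ (totient n div 2) * 4 ^ (k * totient n))
           (if 3 dvd n then n ^ 3 div 3 else n ^ 3)"
proof -
  let ?H = "{j. 0 < j \<and> 2 * j < n}"
  let ?M = "if 3 dvd n then n ^ 3 div 3 else n ^ 3"
  define A where "A = (\<Prod>j\<in>half_totatives n. int j)"
  have fin: "finite ?H"
    by (rule finite_subset[of _ "{..n}"]) auto
  \<comment> \<open>Moebius inversion requires nonzero factors; here \<open>j < n\<close> \<le>
    \<open>k * n\<close>.\<close>
  have nz: "(of_nat (k * n) - of_nat j) / of_nat j \<noteq> (0 :: rat)" if "j \<in> ?H" for j
  proof -
    have "n \<le> k * n" using assms(1) by simp
    then have "j \<noteq> k * n" using that by auto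
    then show ?thesis
      using that by (metis divide_eq_0_iff eq_iff_diff_eq_0 mem_Collect_eq of_nat_0_eq_iff of_nat_eq_iff less_irrefl)
  qed
  have "(\<Prod>d | d dvd n. (of_nat ((k * d - 1) choose ((d - 1) div 2)) :: rat) powi moebius_mu (n div d))
      = (\<Prod>d | d dvd n. (\<Prod>j | j \<in> ?H \<and> n div d dvd j. (of_nat (k * n) - of_nat j) / of_nat j) powi moebius_mu (n div d))"
    using assms by (intro prod.cong refl arg_cong2[where f = "(powi)"] binomial_eq_prod_multiples) auto
  also have "\<dots> = (\<Prod>j | j \<in> ?H \<and> coprime j n. (of_nat (k * n) - of_nat j) / of_nat j)"
    using assms fin nz by (intro prod_moebius_mu_coprime) auto
  also have "\<dots> = (\<Prod>j\<in>half_totatives n. of_int (int (k * n) - int j) / of_int (int j))"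
    by (intro prod.cong) (auto simp: half_totatives_def)
  also have "\<dots> = of_int (\<Prod>j\<in>half_totatives n. int (k * n) - int j) / of_int A"
    by (simp add: A_def prod_dividef)
  finally have eq: "(\<Prod>d | d dvd n. (of_nat ((k * d - 1) choose ((d - 1) div 2)) :: rat) powi moebius_mu (n div d))
      = of_int (\<Prod>j\<in>half_totatives n. int (k * n) - int j) / of_int A" .
  have "coprime A (int n ^ 3)"
    unfolding A_def by (intro prod_coprime_left) (auto simp: half_totatives_def)
  moreover have "int ?M dvd int n ^ 3"
    using cube_modulus_dvd_cube[of n] by (metis of_nat_dvd_iff of_nat_power)
  ultimately have "coprime A (int ?M)"
    using coprime_divisors dvd_refl by blast
  moreover have "A \<noteq> 0"
    by (simp add: A_def) (simp add: half_totatives_def)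
  ultimately have "rat_cong (of_int (\<Prod>j\<in>half_totatives n. int (k * n) - int j) / of_int A)
      (of_int ((- 1) ^ (totient n div 2) * 4 ^ (k * totient n))) ?M"
    using prod_half_totatives_cong[OF assms(2,3)] by (intro rat_cong_divideI) (auto simp: A_def)
  then show ?thesis
    unfolding eq by simp
qed

end
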